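(* Let $x^0\in\mathrm{Range}(\mathbf{B}^{-1}\mathbf{A}^\top)$ and let $(x^k)_{k\ge 0}$ be the iterates of the max-distance sketch-and-project method, i.e. for every $k\ge 0$ $$i_k\in\arg\max_{i=1,\dots,q} f_i(x^k),\qquad x^{k+1}=x^k-\mathbf{B}^{-1}\mathbf{A}^\top\mathbf{H}_{i_k}(\mathbf{A}x^k-b).$$ Then for all $k\ge 0$ $$\|x^{k}-x^*\|_{\mathbf{B}}^2\le\bigl(1-\sigma_\infty^2(\mathbf{B},\mathbf{S})\bigr)^k\,\|x^{0}-x^*\|_{\mathbf{B}}^2 .$$
   Context: Setting: $\mathbf{A}\in\mathbb{R}^{m\times n}$ is a nonzero matrix and $b\in\mathbb{R}^m$ is such that $\mathbf{A}x=b$ is consistent. $\mathbf{B}\in\mathbb{R}^{n\times n}$ is symmetric positive definite. For positive semidefinite $\mathbf{G}$, $\|v\|_{\mathbf{G}}^2=\langle v,\mathbf{G}v\rangle$. $x^*$ is the solution of $\mathbf{A}x=b$ minimizing $\frac12\|x\|_{\mathbf{B}}^2$. $\mathbf{S}_1,\dots,\mathbf{S}_q\in\mathbb{R}^{m\times\tau}$ is a finite family of sketching matrices, collectively denoted $\mathbf{S}$. With $\dagger$ the Moore–Penrose pseudoinverse, $$\mathbf{H}_i=\mathbf{S}_i(\mathbf{S}_i^\top\mathbf{A}\mathbf{B}^{-1}\mathbf{A}^\top\mathbf{S}_i)^\dagger\mathbf{S}_i^\top,\qquad \mathbf{Z}_i=\mathbf{B}^{-1/2}\mathbf{A}^\top\mathbf{H}_i\mathbf{A}\mathbf{B}^{-1/2},\qquad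 f_i(x)=\|\mathbf{A}x-b\|_{\mathbf{H}_i}^2 .$$ The spectral constant is $$\sigma_\infty^2(\mathbf{B},\mathbf{S})=\min_{0\ne v\in\mathrm{Range}(\mathbf{B}^{-1}\mathbf{A}^\top)}\ \max_{i=1,\dots,q}\frac{\|\mathbf{B}^{1/2}v\|_{\mathbf{Z}_i}^2}{\|v\|_{\mathbf{B}}^2}.$$ *)

theory Defs
  imports "HOL-Analysis.Analysis"
begin

definition pos_semidef :: "real^'n^'n \<Rightarrow> bool" where
  "pos_semidef G \<longleftrightarrow> transpose G = G \<and> (\<forall>v. 0 \<le> v \<bullet> (G *v v))"

definition pos_def :: "real^'n^'n \<Rightarrow> bool" where
  "pos_def G \<longleftrightarrow> transpose G = G \<and> (\<forall>v. v \<noteq> 0 \<longrightarrow> 0 < v \<bullet> (G *v v))"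

(* Moore-Penrose pseudoinverse, characterised by the four Penrose equations,
   which have exactly one solution for every real matrix. *)
definition pinv :: "real^'n^'m \<Rightarrow> real^'m^'n" where
  "pinv M = (THE X. M ** X ** M = M \<and> X ** M ** X = X \<and>
                    transpose (M ** X) = M ** X \<and> transpose (X ** M) = X ** M)"

(* The square root G^(1/2): the unique symmetric positive semidefinite R with R R = G
   (meaningful for positive semidefinite G). *)
definition psd_sqrt :: "real^'n^'n \<Rightarrow> real^'n^'n" where
  "psd_sqrt G = (THE R. pos_semidef R \<and> R ** R = G)"

definition wnorm_sq :: "real^'n^'n \<Rightarrow> real^'n \<Rightarrow> real" where
  "wnorm_sq G v = v \<bullet> (G *v v)"

definition min_norm_sol :: "real^'n^'m \<Rightarrow> real^'n^'n \<Rightarrow> real^'m \<Rightarrow> real^'n" where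
  "min_norm_sol A B b = arg_min (\<lambda>x. 1/2 * wnorm_sq B x) (\<lambda>x. A *v x = b)"

definition sketch_H :: "real^'n^'m \<Rightarrow> real^'n^'n \<Rightarrow> real^'t^'m \<Rightarrow> real^'m^'m" where
  "sketch_H A B S =
     S ** pinv (transpose S ** A ** matrix_inv B ** transpose A ** S) ** transpose S"

definition sketch_Z :: "real^'n^'m \<Rightarrow> real^'n^'n \<Rightarrow> real^'t^'m \<Rightarrow> real^'n^'n" where
  "sketch_Z A B S =
     matrix_inv (psd_sqrt B) ** transpose A ** sketch_H A B S ** A ** matrix_inv (psd_sqrt B)"

definition sketch_loss ::
  "real^'n^'m \<Rightarrow> real^'n^'n \<Rightarrow> real^'m \<Rightarrow> real^'t^'m \<Rightarrow> real^'n \<Rightarrow> real" where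
  "sketch_loss A B b S x = wnorm_sq (sketch_H A B S) (A *v x - b)"

(* The family of sketching matrices is S 1, ..., S q.  LEAST denotes the minimum of the set
   of values, which is attained when A is nonzero, B is positive definite and q \<ge> 1. *)
definition sigma_inf_sq ::
  "real^'n^'m \<Rightarrow> real^'n^'n \<Rightarrow> nat \<Rightarrow> (nat \<Rightarrow> real^'t^'m) \<Rightarrow> real" where
  "sigma_inf_sq A B q S =
     (LEAST s. s \<in> {(MAX i\<in>{1..q}. wnorm_sq (sketch_Z A B (S i)) (psd_sqrt B *v v) / wnorm_sq B v)
                     | v. v \<noteq> 0 \<and> v \<in> range ((*v) (matrix_inv B ** transpose A))})"

end

theory Submission
  imports Defs
begin

text \<open>
  Write \<open>e\<^sub>k = x\<^sub>k - x\<^sup>*\<close> for the error, \<open>W = A B\<^sup>-\<^sup>1 A\<^sup>T\<close>, and \<open>H\<close> for the matrix of the sketch chosen in step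
  \<open>k\<close>. The residual is \<open>A x\<^sub>k - b = A e\<^sub>k\<close>, so one step maps \<open>e\<^sub>k\<close> to \<open>e\<^sub>k - B\<^sup>-\<^sup>1 A\<^sup>T H A e\<^sub>k\<close>. The
  pseudoinverse in \<open>H\<close> makes \<open>H W H = H\<close>; hence the step is a \<open>B\<close>-orthogonal projection, and
  Pythagoras (\<open>wnorm_sq_sketch_step\<close>) says that the squared \<open>B\<close>-norm of the error drops by exactly
  \<open>\<parallel>A e\<^sub>k\<parallel>\<^sup>2\<close> in the \<open>H\<close>-seminorm. This drop is the value at \<open>x\<^sub>k\<close> of the loss of the chosen
  sketch, that is, the largest loss of all the sketches, by the max-distance rule.

  On the other hand \<open>\<parallel>B\<^sup>1\<^sup>/\<^sup>2 v\<parallel>\<^sup>2\<close> in the \<open>Z\<^sub>i\<close>-seminorm is \<open>\<parallel>A v\<parallel>\<^sup>2\<close> in the \<open>H\<^sub>i\<close>-seminorm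
  (\<open>wnorm_sq_sketch_Z\<close>). So the largest loss is at least the spectral constant times
  \<open>\<parallel>e\<^sub>k\<parallel>\<^sup>2\<close> as long as the error stays in the range of \<open>B\<^sup>-\<^sup>1 A\<^sup>T\<close>, over which the constant is a
  minimum (\<open>sigma_inf_sq_le\<close>). It does stay there: the starting point and every step lie in that
  range, and so does the minimum norm solution \<open>x\<^sup>*\<close> (\<open>min_norm_sol_props\<close>). Each step therefore
  contracts by \<open>1 - \<sigma>\<close>, and the factors can be multiplied since \<open>\<sigma> \<le> 1\<close>: no step can decrease
  the squared error by more than all of it.

  The pseudoinverse and the square root are given as definite descriptions, so their existence and
  uniqueness has to be proved before anything is known about them. Both come from an orthonormal
  eigenbasis of a symmetric matrix, by applying \<open>\<lambda> \<mapsto> \<lambda>\<^sup>-\<^sup>1\<close> (with \<open>0\<^sup>-\<^sup>1 = 0\<close>) or \<open>\<lambda> \<mapsto> \<surd>\<lambda>\<close> to the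
  eigenvalues.
\<close>

section \<open>Orthonormal eigenbases of self-adjoint maps\<close>

text \<open>First-order condition at a minimum, in the form used for the Rayleigh quotient below.\<close>
lemma linear_coefficient_zero:
  fixes a c :: real
  assumes "\<And>t. 0 \<le> 2 * t * a + t\<^sup>2 * c"
  shows "a = 0"
proof (rule ccontr)
  assume "a \<noteq> 0"
  define d where "d = \<bar>c\<bar> + 1"
  have d: "d > 0" "c < d" by (auto simp: d_def)
  \<comment> \<open>If \<open>c > 0\<close>, the minimizer is \<open>t = -a / c\<close>; replacing \<open>c\<close> by the larger and positive \<open>d\<close>
     covers all signs of \<open>c\<close>.\<close>
  have "0 \<le> 2 * (-a/d) * a + (-a/d)\<^sup>2 * c" by (rule assms)
  also have "\<dots> = (a\<^sup>2 / d) * (c/d - 2)"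
    using d by (simp add: field_simps power2_eq_square)
  finally have "0 \<le> (a\<^sup>2 / d) * (c/d - 2)" .
  moreover have "c/d - 2 < 0" using d by (simp add: field_simps)
  moreover have "a\<^sup>2 / d > 0" using d \<open>a \<noteq> 0\<close> by simp
  ultimately show False by (smt (verit) mult_pos_neg)
qed

text \<open>
  The eigenvector is a maximizer \<open>u\<close> of \<open>x \<bullet> f x\<close> on the unit sphere of \<open>V\<close>, with value \<open>c\<close>. Then the
  form \<open>c (x \<bullet> x) - x \<bullet> f x\<close> is nonnegative on \<open>V\<close> and vanishes at \<open>u\<close>, so that its derivative at
  \<open>u\<close> in the direction \<open>c u - f u \<in> V\<close> is zero. That derivative is \<open>2 \<parallel>c u - f u\<parallel>\<^sup>2\<close>.
\<close>
lemma self_adjoint_has_eigenvector: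
  fixes f :: "'a::euclidean_space \<Rightarrow> 'a"
  assumes lin: "linear f" and adj: "\<And>x y. f x \<bullet> y = x \<bullet> f y"
    and V: "subspace V" "f ` V \<subseteq> V" "V \<noteq> {0}"
  obtains u c where "u \<in> V" "norm u = 1" "f u = c *\<^sub>R u"
proof -
  let ?K = "V \<inter> sphere 0 1"
  have compact: "compact ?K" by (simp add: V(1) closed_Int_compact closed_subspace)
  have nonempty: "?K \<noteq> {}"
  proof -
    obtain v where v: "v \<in> V" "v \<noteq> 0" using V subspace_0 by blast
    have "(1 / norm v) *\<^sub>R v \<in> ?K"
      using v V(1) by (simp add: subspace_scale)
    then show ?thesis by blast
  qed
  have continuous: "continuous_on ?K (\<lambda>x. x \<bullet> f x)"
    by (intro continuous_intros linear_continuous_on linear_conv_bounded_linear[THEN iffD1] lin)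
  obtain u where u: "u \<in> ?K" "\<And>x. x \<in> ?K \<Longrightarrow> x \<bullet> f x \<le> u \<bullet> f u"
    using continuous_attains_sup[OF compact nonempty continuous] by blast
  define c where "c = u \<bullet> f u"
  have uu: "u \<bullet> u = 1" using u(1) by (simp add: dot_square_norm)
  have form_nonneg: "0 \<le> c * (x \<bullet> x) - x \<bullet> f x" if "x \<in> V" for x
  proof (cases "x = 0")
    case True then show ?thesis by (simp add: lin linear_0)
  next
    case False
    have "(1 / norm x) *\<^sub>R x \<in> ?K" using that False V(1) by (simp add: subspace_scale)
    from u(2)[OF this] have "(x \<bullet> f x) / (norm x)\<^sup>2 \<le> c"
      by (simp add: c_def linear_scale[OF lin] power2_eq_square)
    then show ?thesis using False by (simp add: field_simps dot_square_norm)
  qed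
  define y where "y = c *\<^sub>R u - f u"
  have yV: "y \<in> V" unfolding y_def using u(1) V by (intro subspace_diff subspace_scale) auto
  have swap: "u \<bullet> f y = y \<bullet> f u" "u \<bullet> y = y \<bullet> u"
    by (metis adj inner_commute) (rule inner_commute)
  have "y \<bullet> y = 0"
  proof (rule linear_coefficient_zero)
    fix t :: real
    have "u + t *\<^sub>R y \<in> V" using u(1) yV V(1) by (simp add: subspace_add subspace_scale)
    from form_nonneg[OF this]
    have "0 \<le> c * ((u + t *\<^sub>R y) \<bullet> (u + t *\<^sub>R y)) - (u + t *\<^sub>R y) \<bullet> (f u + t *\<^sub>R f y)"
      by (simp add: linear_add[OF lin] linear_scale[OF lin])
    also have "\<dots> = (c * (u \<bullet> u) - u \<bullet> f u) + 2 * t * (y \<bullet> (c *\<^sub>R u - f u))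
        + t\<^sup>2 * (c * (y \<bullet> y) - y \<bullet> f y)"
      by (simp add: inner_add_left inner_add_right inner_diff_right swap)
        (simp add: algebra_simps power2_eq_square)
    finally show "0 \<le> 2 * t * (y \<bullet> y) + t\<^sup>2 * (c * (y \<bullet> y) - y \<bullet> f y)"
      by (simp add: uu c_def[symmetric] y_def[symmetric])
  qed
  then have "f u = c *\<^sub>R u" by (simp add: y_def)
  with u(1) that show ?thesis by auto
qed

text \<open>
  The spectral theorem. It is stated for invariant subspaces because the induction splits off an
  eigenvector and continues in its orthogonal complement, which is invariant by self-adjointness.
\<close>
lemma self_adjoint_orthonormal_eigenbasis:
  fixes f :: "'a::euclidean_space \<Rightarrow> 'a"
  assumes lin: "linear f" and adj: "\<And>x y. f x \<bullet> y = x \<bullet> f y"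
    and "subspace V" "f ` V \<subseteq> V"
  shows "\<exists>E. finite E \<and> E \<subseteq> V \<and> pairwise orthogonal E \<and> (\<forall>e\<in>E. norm e = 1) \<and> V \<subseteq> span E
      \<and> (\<forall>e\<in>E. \<exists>c. f e = c *\<^sub>R e)"
  using assms(3,4)
proof (induction "dim V" arbitrary: V rule: less_induct)
  case less
  show ?case
  proof (cases "V = {0}")
    case True
    then show ?thesis by (intro exI[of _ "{}"]) auto
  next
    case False
    then obtain u c where u: "u \<in> V" "norm u = 1" "f u = c *\<^sub>R u"
      using self_adjoint_has_eigenvector[OF lin adj less.prems] by blast
    have uu: "u \<bullet> u = 1" using u by (simp add: dot_square_norm)
    define W where "W = {x \<in> V. u \<bullet> x = 0}"
    have subW: "subspace W"
      using less.prems(1) unfolding W_def subspace_def by (auto simp: inner_simps)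
    have inv: "f ` W \<subseteq> W"
      using less.prems(2) u(3) by (auto simp: W_def adj[symmetric])
    have "u \<notin> W" using uu by (simp add: W_def)
    then have "W \<subset> V" using u(1) unfolding W_def by blast
    then have "dim W < dim V"
      by (metis subW less.prems(1) dim_subset nless_le order_le_less subspace_dim_equal)
    from less.hyps[OF this subW inv] obtain E where E: "finite E" "E \<subseteq> W" "pairwise orthogonal E"
      "\<forall>e\<in>E. norm e = 1" "W \<subseteq> span E" "\<forall>e\<in>E. \<exists>c. f e = c *\<^sub>R e" by blast
    have "V \<subseteq> span (insert u E)"
    proof
      fix v assume v: "v \<in> V"
      have "v - (u \<bullet> v) *\<^sub>R u \<in> W"
        using v u(1) uu less.prems(1) by (simp add: W_def subspace_diff subspace_scale inner_simps)
      then have "v - (u \<bullet> v) *\<^sub>R u \<in> span E" using E(5) by blast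
      then show "v \<in> span (insert u E)" unfolding span_insert by blast
    qed
    moreover have "pairwise orthogonal (insert u E)"
      using E(2,3) unfolding pairwise_insert
      by (auto simp: W_def orthogonal_def inner_commute subset_iff)
    moreover have "insert u E \<subseteq> V" using E(2) u(1) by (auto simp: W_def)
    ultimately show ?thesis using E u by (intro exI[of _ "insert u E"]) blast
  qed
qed

section \<open>Functions of a symmetric matrix\<close>

definition orthonormal_basis :: "(real^'n) set \<Rightarrow> bool" where
  "orthonormal_basis E \<longleftrightarrow>
     finite E \<and> pairwise orthogonal E \<and> (\<forall>e\<in>E. norm e = 1) \<and> span E = UNIV"

text \<open>
  The matrix with eigenvectors \<open>e \<in> E\<close> and eigenvalues \<open>l e\<close>, that is, the sum of \<open>l e\<close> times
  the projection onto \<open>e\<close>. For orthonormal \<open>E\<close> such matrices are multiplied by multiplying \<open>l\<close> pointwise.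
\<close>
definition spectral_sum :: "(real^'n) set \<Rightarrow> (real^'n \<Rightarrow> real) \<Rightarrow> real^'n^'n" where
  "spectral_sum E l = matrix (\<lambda>v. \<Sum>e\<in>E. (l e * (e \<bullet> v)) *\<^sub>R e)"

lemma spectral_sum_mult_vec: "spectral_sum E l *v v = (\<Sum>e\<in>E. (l e * (e \<bullet> v)) *\<^sub>R e)"
proof -
  have "linear (\<lambda>v. \<Sum>e\<in>E. (l e * (e \<bullet> v)) *\<^sub>R e)"
    by (intro linear_compose_sum ballI linearI) (simp_all add: inner_simps algebra_simps)
  from fun_cong[OF matrix_vector_mul(2)[OF this]] show ?thesis by (simp add: spectral_sum_def)
qed

lemma orthonormal_basis_inner:
  assumes "orthonormal_basis E" "d \<in> E" "e \<in> E"
  shows "d \<bullet> e = (if d = e then 1 else 0)"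
  using assms by (auto simp: orthonormal_basis_def pairwise_def orthogonal_def dot_square_norm)

lemma spectral_sum_mult_basis:
  assumes "orthonormal_basis E" "d \<in> E"
  shows "spectral_sum E l *v d = l d *\<^sub>R d"
proof -
  have "spectral_sum E l *v d = (\<Sum>e\<in>E. if e = d then l d *\<^sub>R d else 0)"
    unfolding spectral_sum_mult_vec
    by (rule sum.cong) (auto simp: orthonormal_basis_inner[OF assms(1) _ assms(2)])
  then show ?thesis using assms by (simp add: orthonormal_basis_def)
qed

lemma matrix_eq_on_orthonormal_basis:
  fixes M N :: "real^'n^'m"
  assumes "orthonormal_basis E" "\<And>e. e \<in> E \<Longrightarrow> M *v e = N *v e"
  shows "M = N"
proof -
  have "M *v v = N *v v" for v
    by (rule linear_eq_on_span[of _ _ E]) (use assms in \<open>auto simp: orthonormal_basis_def\<close>)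
  then show ?thesis by (simp add: matrix_eq)
qed

lemma spectral_sum_mult:
  assumes "orthonormal_basis E"
  shows "spectral_sum E l ** spectral_sum E m = spectral_sum E (\<lambda>e. l e * m e)"
  by (rule matrix_eq_on_orthonormal_basis[OF assms])
    (simp add: spectral_sum_mult_basis[OF assms] matrix_vector_mul_assoc[symmetric]
      matrix_vector_mult_scaleR mult.commute)

lemma inner_matrix_transpose: "x \<bullet> (M *v y) = (transpose M *v x) \<bullet> (y :: real^'n)"
  by (simp add: dot_lmul_matrix)

lemma transpose_spectral_sum: "transpose (spectral_sum E l) = spectral_sum E l"
proof -
  have "(transpose (spectral_sum E l) *v v) \<bullet> w = (spectral_sum E l *v v) \<bullet> w" for v w
    unfolding inner_matrix_transpose[symmetric] spectral_sum_mult_vec inner_sum_left inner_sum_right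
    by (rule sum.cong) (simp_all add: inner_commute)
  then show ?thesis by (metis matrix_eq vector_eq_rdot)
qed

lemma symmetric_spectral_decomposition:
  assumes "transpose M = M"
  obtains E l where "orthonormal_basis E" "M = spectral_sum E l"
proof -
  have "\<exists>E. finite E \<and> E \<subseteq> UNIV \<and> pairwise orthogonal E \<and> (\<forall>e\<in>E. norm e = 1) \<and> UNIV \<subseteq> span E
      \<and> (\<forall>e\<in>E. \<exists>c. M *v e = c *\<^sub>R e)"
    by (rule self_adjoint_orthonormal_eigenbasis) (simp_all add: inner_matrix_transpose[of _ M] assms)
  then obtain E where E: "orthonormal_basis E" "\<forall>e\<in>E. \<exists>c. M *v e = c *\<^sub>R e"
    by (auto simp: orthonormal_basis_def)
  then obtain l where l: "\<And>e. e \<in> E \<Longrightarrow> M *v e = l e *\<^sub>R e" by metis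
  have "M = spectral_sum E l"
    by (rule matrix_eq_on_orthonormal_basis[OF E(1)]) (simp add: l spectral_sum_mult_basis[OF E(1)])
  with E(1) that show ?thesis by blast
qed

section \<open>Pseudoinverse and square root\<close>

text \<open>
  \<open>M X\<close> and \<open>M Y\<close> are symmetric idempotents with the same range, hence equal; likewise \<open>X M\<close> and
  \<open>Y M\<close>. Then \<open>X = X M X = Y M Y = Y\<close>.
\<close>
lemma Penrose_unique:
  fixes M :: "real^'n^'m"
  assumes X: "M ** X ** M = M" "X ** M ** X = X" "transpose (M ** X) = M ** X" "transpose (X ** M) = X ** M"
    and Y: "M ** Y ** M = M" "Y ** M ** Y = Y" "transpose (M ** Y) = M ** Y" "transpose (Y ** M) = Y ** M"
  shows "X = Y"
proof -
  have "M ** X = (M ** Y) ** (M ** X)" by (simp add: matrix_mul_assoc Y(1))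
  also have "\<dots> = transpose (M ** Y) ** transpose (M ** X)" unfolding X(3) Y(3) ..
  also have "\<dots> = transpose ((M ** X) ** (M ** Y))" by (rule matrix_transpose_mul[symmetric])
  also have "(M ** X) ** (M ** Y) = M ** Y" by (simp add: matrix_mul_assoc X(1))
  finally have 1: "M ** X = M ** Y" unfolding Y(3) .
  have "X ** M = X ** (M ** Y ** M)" unfolding Y(1) ..
  also have "\<dots> = (X ** M) ** (Y ** M)" by (simp add: matrix_mul_assoc)
  also have "\<dots> = transpose (X ** M) ** transpose (Y ** M)" unfolding X(4) Y(4) ..
  also have "\<dots> = transpose ((Y ** M) ** (X ** M))" by (rule matrix_transpose_mul[symmetric])
  also have "(Y ** M) ** (X ** M) = Y ** (M ** X ** M)" by (simp add: matrix_mul_assoc)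
  also have "\<dots> = Y ** M" unfolding X(1) ..
  finally have 2: "X ** M = Y ** M" unfolding Y(4) .
  have "X = (X ** M) ** X" by (simp add: X(2))
  also have "\<dots> = (Y ** M) ** X" by (simp add: 2)
  also have "\<dots> = Y ** (M ** Y)" by (simp add: matrix_mul_assoc[symmetric] 1)
  also have "\<dots> = Y" by (simp add: matrix_mul_assoc Y(2))
  finally show ?thesis .
qed

lemma pinv_symmetric:
  fixes M :: "real^'n^'n"
  assumes "transpose M = M"
  shows "M ** pinv M ** M = M" "pinv M ** M ** pinv M = pinv M" "transpose (pinv M) = pinv M"
proof -
  obtain E l where E: "orthonormal_basis E" and M: "M = spectral_sum E l"
    using symmetric_spectral_decomposition[OF assms] .
  define X where "X = spectral_sum E (\<lambda>e. inverse (l e))"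
  have [simp]: "x * inverse x * x = x" "inverse x * x * inverse x = inverse x" for x :: real
    by (cases "x = 0"; simp)+
  have X: "M ** X ** M = M" "X ** M ** X = X" "transpose (M ** X) = M ** X" "transpose (X ** M) = X ** M"
    by (simp_all add: M X_def spectral_sum_mult[OF E] transpose_spectral_sum)
  have "pinv M = X"
    unfolding pinv_def
  proof (rule the_equality)
    show "M ** X ** M = M \<and> X ** M ** X = X \<and> transpose (M ** X) = M ** X \<and> transpose (X ** M) = X ** M"
      using X by blast
  next
    fix Y
    assume Y: "M ** Y ** M = M \<and> Y ** M ** Y = Y \<and> transpose (M ** Y) = M ** Y \<and> transpose (Y ** M) = Y ** M"
    show "Y = X" by (rule Penrose_unique[of M]) (simp_all only: X Y)
  qed
  then show "M ** pinv M ** M = M" "pinv M ** M ** pinv M = pinv M" "transpose (pinv M) = pinv M"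
    using X by (simp_all add: X_def transpose_spectral_sum)
qed

text \<open>
  This makes a positive semidefinite root unique, as it forces the action of any root on an eigenbasis.
  Factor \<open>R\<^sup>2 - c\<^sup>2 = (R + c)(R - c)\<close>: for \<open>c > 0\<close> the factor \<open>R + c\<close> is positive definite and can
  be cancelled, and for \<open>c = 0\<close> the kernels of \<open>R\<^sup>2\<close> and of the symmetric \<open>R\<close> agree.
\<close>
lemma pos_semidef_root_eigenvector:
  assumes R: "pos_semidef R" and c: "c \<ge> 0" and "(R ** R) *v e = c\<^sup>2 *\<^sub>R e"
  shows "R *v e = c *\<^sub>R e"
proof -
  define y where "y = R *v e - c *\<^sub>R e"
  have Ry: "R *v y + c *\<^sub>R y = 0"
    using assms(3) unfolding y_def
    by (simp add: matrix_vector_mul_assoc[symmetric] algebra_simps matrix_vector_mult_scaleR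
        matrix_vector_mult_diff_distrib power2_eq_square)
  have "y \<bullet> (R *v y) + c * (y \<bullet> y) = 0"
    using arg_cong[OF Ry, of "\<lambda>z. y \<bullet> z"] by (simp add: inner_simps)
  moreover have "y \<bullet> (R *v y) \<ge> 0" using R by (simp add: pos_semidef_def)
  moreover have "c * (y \<bullet> y) \<ge> 0" using c by simp
  ultimately have cy: "c * (y \<bullet> y) = 0" by linarith
  show ?thesis
  proof (cases "c = 0")
    case True
    have "(R *v e) \<bullet> (R *v e) = e \<bullet> (R *v (R *v e))"
      using R by (simp add: inner_matrix_transpose[of e] pos_semidef_def)
    also have "\<dots> = 0" using assms(3) True by (simp add: matrix_vector_mul_assoc)
    finally show ?thesis using True by simp
  next
    case False
    then show ?thesis using cy by (simp add: y_def)
  qed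
qed

lemma psd_sqrt_works:
  assumes "pos_semidef G"
  shows "pos_semidef (psd_sqrt G)" "psd_sqrt G ** psd_sqrt G = G"
proof -
  obtain E l where E: "orthonormal_basis E" and G: "G = spectral_sum E l"
    using symmetric_spectral_decomposition assms unfolding pos_semidef_def by blast
  have l: "l e \<ge> 0" if "e \<in> E" for e
  proof -
    have "0 \<le> e \<bullet> (G *v e)" using assms by (simp add: pos_semidef_def)
    then show ?thesis
      using that by (simp add: G spectral_sum_mult_basis[OF E] orthonormal_basis_inner[OF E])
  qed
  define R where "R = spectral_sum E (\<lambda>e. sqrt (l e))"
  have RR: "R ** R = G"
    by (rule matrix_eq_on_orthonormal_basis[OF E])
      (simp add: R_def G spectral_sum_mult[OF E] spectral_sum_mult_basis[OF E] l)
  have "0 \<le> v \<bullet> (R *v v)" for v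
    unfolding R_def spectral_sum_mult_vec inner_sum_right
    by (rule sum_nonneg) (simp add: l inner_commute mult.assoc)
  then have R: "pos_semidef R" by (simp add: pos_semidef_def R_def transpose_spectral_sum)
  have uniq: "T = R" if T: "pos_semidef T" "T ** T = G" for T
  proof (rule matrix_eq_on_orthonormal_basis[OF E])
    fix e assume e: "e \<in> E"
    have "T *v e = sqrt (l e) *\<^sub>R e"
      by (rule pos_semidef_root_eigenvector[OF T(1)])
        (use e l in \<open>simp_all add: T(2) G spectral_sum_mult_basis[OF E]\<close>)
    then show "T *v e = R *v e" by (simp add: R_def spectral_sum_mult_basis[OF E e])
  qed
  have "psd_sqrt G = R"
    unfolding psd_sqrt_def using R RR uniq by (intro the_equality conjI) blast+
  then show "pos_semidef (psd_sqrt G)" "psd_sqrt G ** psd_sqrt G = G"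
    using R RR by simp_all
qed

section \<open>Positive definite matrices\<close>

lemma matrix_inv_eqs:
  fixes M :: "real^'n^'n"
  assumes "\<And>v. M *v v = 0 \<Longrightarrow> v = 0"
  shows "M ** matrix_inv M = mat 1" "matrix_inv M ** M = mat 1"
proof -
  have "\<exists>N. N ** M = mat 1" using assms by (simp add: matrix_left_invertible_ker)
  then have "\<exists>N. M ** N = mat 1 \<and> N ** M = mat 1" using matrix_left_right_inverse by blast
  then have "M ** matrix_inv M = mat 1 \<and> matrix_inv M ** M = mat 1"
    unfolding matrix_inv_def by (rule someI_ex)
  then show "M ** matrix_inv M = mat 1" "matrix_inv M ** M = mat 1" by auto
qed

lemma pos_def_imp_pos_semidef: "pos_def G \<Longrightarrow> pos_semidef G"
  unfolding pos_def_def pos_semidef_def by (metis inner_zero_left less_eq_real_def order_refl)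

lemma pos_def_matrix_inv:
  assumes "pos_def B"
  shows "B ** matrix_inv B = mat 1" "matrix_inv B ** B = mat 1" "pos_def (matrix_inv B)"
proof -
  have ker: "v = 0" if "B *v v = 0" for v
    using assms that unfolding pos_def_def by (metis inner_zero_right less_irrefl)
  show 1: "B ** matrix_inv B = mat 1" and 2: "matrix_inv B ** B = mat 1"
    using matrix_inv_eqs[of B] ker by auto
  have Bsym: "transpose B = B" using assms by (simp add: pos_def_def)
  have "transpose (matrix_inv B) ** B = mat 1"
    using arg_cong[OF 1, of transpose] by (simp add: matrix_transpose_mul Bsym)
  then have sym: "transpose (matrix_inv B) = matrix_inv B"
    using matrix_mul_assoc[of "transpose (matrix_inv B)" B "matrix_inv B"] 1 by simp
  have "0 < v \<bullet> (matrix_inv B *v v)" if "v \<noteq> 0" for v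
  proof -
    define w where "w = matrix_inv B *v v"
    have v: "v = B *v w" by (simp add: w_def matrix_vector_mul_assoc 1)
    then have "w \<noteq> 0" using that by auto
    then have "0 < w \<bullet> (B *v w)" using assms by (simp add: pos_def_def)
    also have "\<dots> = v \<bullet> (matrix_inv B *v v)" unfolding v[symmetric] w_def[symmetric] by (rule inner_commute)
    finally show ?thesis .
  qed
  with sym show "pos_def (matrix_inv B)" by (simp add: pos_def_def)
qed

lemma wnorm_sq_pos: "pos_def B \<Longrightarrow> v \<noteq> 0 \<Longrightarrow> 0 < wnorm_sq B v"
  by (simp add: pos_def_def wnorm_sq_def)

lemma wnorm_sq_zero [simp]: "wnorm_sq B 0 = 0"
  by (simp add: wnorm_sq_def)

lemma wnorm_sq_nonneg: "pos_def B \<Longrightarrow> 0 \<le> wnorm_sq B v"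
  by (cases "v = 0") (auto dest: wnorm_sq_pos less_imp_le)

lemma pos_def_root_invertible:
  assumes "pos_def B"
  shows "psd_sqrt B ** matrix_inv (psd_sqrt B) = mat 1" "matrix_inv (psd_sqrt B) ** psd_sqrt B = mat 1"
proof -
  have RR: "psd_sqrt B ** psd_sqrt B = B"
    using assms by (intro psd_sqrt_works pos_def_imp_pos_semidef)
  have "v = 0" if "psd_sqrt B *v v = 0" for v
  proof (rule ccontr)
    assume "v \<noteq> 0"
    then have "0 < v \<bullet> (B *v v)" using assms by (simp add: pos_def_def)
    moreover have "B *v v = psd_sqrt B *v (psd_sqrt B *v v)"
      by (simp add: matrix_vector_mul_assoc RR)
    ultimately show False using that by simp
  qed
  then show "psd_sqrt B ** matrix_inv (psd_sqrt B) = mat 1" "matrix_inv (psd_sqrt B) ** psd_sqrt B = mat 1"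
    using matrix_inv_eqs[of "psd_sqrt B"] by auto
qed

section \<open>One sketch-and-project step\<close>

text \<open>The factors \<open>B\<^sup>-\<^sup>1\<^sup>/\<^sup>2\<close> on both sides of \<open>Z\<close> cancel against \<open>B\<^sup>1\<^sup>/\<^sup>2\<close>.\<close>
lemma wnorm_sq_sketch_Z:
  assumes "pos_def B"
  shows "wnorm_sq (sketch_Z A B S) (psd_sqrt B *v v) = wnorm_sq (sketch_H A B S) (A *v v)"
proof -
  let ?R = "psd_sqrt B"
  have Rsym: "transpose ?R = ?R"
    using psd_sqrt_works(1)[OF pos_def_imp_pos_semidef[OF assms]] by (simp add: pos_semidef_def)
  have "?R ** sketch_Z A B S ** ?R
      = (?R ** matrix_inv ?R) ** transpose A ** sketch_H A B S ** A ** (matrix_inv ?R ** ?R)"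
    by (simp add: sketch_Z_def matrix_mul_assoc)
  also have "\<dots> = transpose A ** sketch_H A B S ** A"
    by (simp add: pos_def_root_invertible[OF assms])
  finally have eq: "?R ** sketch_Z A B S ** ?R = transpose A ** sketch_H A B S ** A" .
  have "wnorm_sq (sketch_Z A B S) (?R *v v) = v \<bullet> ((?R ** sketch_Z A B S ** ?R) *v v)"
    unfolding wnorm_sq_def
    by (simp add: inner_matrix_transpose[of v ?R] Rsym matrix_vector_mul_assoc[symmetric])
  also have "\<dots> = wnorm_sq (sketch_H A B S) (A *v v)"
    unfolding wnorm_sq_def eq
    by (simp add: inner_matrix_transpose[of v "transpose A"] matrix_vector_mul_assoc[symmetric]
        del: transpose_matrix_vector)
  finally show ?thesis .
qed

text \<open>
  The second identity is \<open>X M X = X\<close> for the pseudoinverse \<open>X\<close> of \<open>M = S\<^sup>T A B\<^sup>-\<^sup>1 A\<^sup>T S\<close>, multiplied by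
  \<open>S\<close> and \<open>S\<^sup>T\<close>. It is what makes the step below a projection.
\<close>
lemma sketch_H_props:
  assumes "pos_def B"
  shows "transpose (sketch_H A B S) = sketch_H A B S"
    and "sketch_H A B S ** (A ** matrix_inv B ** transpose A) ** sketch_H A B S = sketch_H A B S"
proof -
  let ?M = "transpose S ** A ** matrix_inv B ** transpose A ** S"
  have "transpose (matrix_inv B) = matrix_inv B"
    using pos_def_matrix_inv(3)[OF assms] by (simp add: pos_def_def)
  then have "transpose ?M = ?M"
    by (simp add: matrix_transpose_mul matrix_mul_assoc)
  note X = pinv_symmetric[OF this]
  show "transpose (sketch_H A B S) = sketch_H A B S"
    by (simp add: sketch_H_def matrix_transpose_mul X(3) matrix_mul_assoc)
  have "sketch_H A B S ** (A ** matrix_inv B ** transpose A) ** sketch_H A B S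
      = S ** (pinv ?M ** ?M ** pinv ?M) ** transpose S"
    by (simp add: sketch_H_def matrix_mul_assoc)
  then show "sketch_H A B S ** (A ** matrix_inv B ** transpose A) ** sketch_H A B S = sketch_H A B S"
    unfolding X(2) by (simp add: sketch_H_def)
qed

text \<open>
  The step direction \<open>d\<close> satisfies \<open>\<langle>d, d\<rangle> = \<langle>e, d\<rangle>\<close> in the inner product of \<open>B\<close>, because
  \<open>H A B\<^sup>-\<^sup>1 A\<^sup>T H = H\<close>. So \<open>e - d\<close> and \<open>d\<close> are \<open>B\<close>-orthogonal, and
  \<open>\<langle>e, d\<rangle> = \<langle>A e, H A e\<rangle>\<close> is the decrease.
\<close>
lemma wnorm_sq_sketch_step:
  fixes A :: "real^'n^'m"
  assumes "pos_def B"
  shows "wnorm_sq B (e - (matrix_inv B ** transpose A ** sketch_H A B S) *v (A *v e))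
       = wnorm_sq B e - wnorm_sq (sketch_H A B S) (A *v e)"
proof -
  let ?H = "sketch_H A B S"
  define g where "g = ?H *v (A *v e)"
  define d where "d = matrix_inv B *v (transpose A *v g)"
  have d: "(matrix_inv B ** transpose A ** ?H) *v (A *v e) = d"
    by (simp add: d_def g_def matrix_vector_mul_assoc[symmetric] del: transpose_matrix_vector)
  have Bd: "B *v d = transpose A *v g"
    by (simp add: d_def matrix_vector_mul_assoc matrix_mul_assoc pos_def_matrix_inv[OF assms]
        del: transpose_matrix_vector)
  have eBd: "u \<bullet> (B *v d) = (A *v u) \<bullet> g" for u
    by (simp add: Bd inner_matrix_transpose[of u "transpose A"] del: transpose_matrix_vector)
  have dBe: "d \<bullet> (B *v e) = (A *v e) \<bullet> g"
    using assms inner_matrix_transpose[of d B e] eBd[of e] by (simp add: pos_def_def inner_commute)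
  have "?H *v (A *v d) = g"
    using sketch_H_props(2)[OF assms, of A S]
    by (simp add: d_def g_def matrix_vector_mul_assoc matrix_mul_assoc del: transpose_matrix_vector)
  then have dd: "(A *v d) \<bullet> g = (A *v e) \<bullet> g"
    using inner_matrix_transpose[of "A *v d" ?H "A *v e"] sketch_H_props(1)[OF assms, of A S]
    by (simp add: g_def inner_commute del: transpose_matrix_vector)
  show ?thesis
    unfolding d wnorm_sq_def
    by (simp add: matrix_vector_mult_diff_distrib inner_diff_left inner_diff_right eBd dBe dd g_def[symmetric])
qed

section \<open>The minimum norm solution\<close>

lemma matrix_diff_mult: "(M - N) ** P = M ** P - N ** (P :: real^'k^'n)"
  by (simp add: matrix_matrix_mult_def vec_eq_iff sum_subtractf left_diff_distrib)

lemma transpose_eq_zero_iff: "transpose M = 0 \<longleftrightarrow> (M :: real^'n^'m) = 0"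
  by (auto simp: transpose_def vec_eq_iff)

text \<open>
  The range of \<open>M = A C A\<^sup>T\<close> is the whole range of \<open>A\<close>, so the projection \<open>M M\<^sup>\<dagger>\<close> onto it fixes
  \<open>A\<close>. For the proof let \<open>F = M M\<^sup>\<dagger> - 1\<close> and \<open>D = F A\<close>: since \<open>F M = 0\<close>, also \<open>D C D\<^sup>T = F M F\<^sup>T = 0\<close>,
  and \<open>D = 0\<close> as \<open>C\<close> is positive definite.
\<close>
lemma Gram_pinv_fixes:
  fixes A :: "real^'n^'m"
  assumes "pos_def C"
  shows "(A ** C ** transpose A) ** pinv (A ** C ** transpose A) ** A = A"
proof -
  let ?M = "A ** C ** transpose A"
  have Msym: "transpose ?M = ?M"
    using assms by (simp add: pos_def_def matrix_transpose_mul matrix_mul_assoc)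
  note X = pinv_symmetric[OF Msym]
  define D where "D = ?M ** pinv ?M ** A - A"
  define F where "F = ?M ** pinv ?M - mat 1"
  have D: "D = F ** A" by (simp add: D_def F_def matrix_diff_mult)
  have "F ** ?M = 0" by (simp add: F_def matrix_diff_mult X(1))
  have "transpose D *v w = 0" for w
  proof (rule ccontr)
    let ?z = "transpose D *v w"
    assume "?z \<noteq> 0"
    then have "0 < ?z \<bullet> (C *v ?z)" using assms by (simp add: pos_def_def)
    also have "?z \<bullet> (C *v ?z) = w \<bullet> (F *v (A *v (C *v ?z)))"
    proof -
      have "transpose D *v w = transpose A *v (transpose F *v w)"
        unfolding D matrix_transpose_mul matrix_vector_mul_assoc ..
      then show ?thesis
        by (simp only: inner_matrix_transpose[of w F] inner_matrix_transpose[of _ A])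
    qed
    also have "\<dots> = w \<bullet> ((F ** ?M ** transpose F) *v w)"
      by (simp add: D matrix_transpose_mul matrix_vector_mul_assoc matrix_mul_assoc
          del: transpose_matrix_vector)
    also have "\<dots> = 0" by (simp add: \<open>F ** ?M = 0\<close>)
    finally show False by simp
  qed
  then have "transpose D = 0" by (simp add: matrix_eq del: transpose_matrix_vector)
  then have "D = 0" by (simp add: transpose_eq_zero_iff)
  then show ?thesis by (simp add: D_def)
qed

text \<open>
  With \<open>M = A B\<^sup>-\<^sup>1 A\<^sup>T\<close>, the vector \<open>s = B\<^sup>-\<^sup>1 A\<^sup>T M\<^sup>\<dagger> b\<close> is a solution in the range of \<open>B\<^sup>-\<^sup>1 A\<^sup>T\<close>.
  That range is the \<open>B\<close>-orthogonal complement of the kernel of \<open>A\<close>, so any other solution has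
  strictly larger norm by Pythagoras, and \<open>s\<close> is the minimizer.
\<close>
lemma min_norm_sol_props:
  fixes A :: "real^'n^'m"
  assumes B: "pos_def B" and "\<exists>y. A *v y = b"
  shows "A *v min_norm_sol A B b = b"
    and "min_norm_sol A B b \<in> range ((*v) (matrix_inv B ** transpose A))"
proof -
  let ?M = "A ** matrix_inv B ** transpose A"
  obtain y where y: "A *v y = b" using assms by blast
  define w where "w = pinv ?M *v b"
  define s where "s = (matrix_inv B ** transpose A) *v w"
  have As: "A *v s = b"
    using Gram_pinv_fixes[OF pos_def_matrix_inv(3)[OF B], of A]
    by (simp add: s_def w_def y[symmetric] matrix_vector_mul_assoc matrix_mul_assoc)
  have Bs: "B *v s = transpose A *v w"
    by (simp add: s_def matrix_vector_mul_assoc matrix_mul_assoc pos_def_matrix_inv[OF B]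
        del: transpose_matrix_vector)
  have pythagoras: "wnorm_sq B z = wnorm_sq B s + wnorm_sq B (z - s)" if "A *v z = b" for z
  proof -
    define d where "d = z - s"
    have "A *v d = 0" by (simp add: d_def matrix_vector_mult_diff_distrib that As)
    then have dBs: "d \<bullet> (B *v s) = 0"
      by (simp add: Bs inner_matrix_transpose[of d "transpose A"] del: transpose_matrix_vector)
    then have sBd: "s \<bullet> (B *v d) = 0"
      using B inner_matrix_transpose[of s B d] by (simp add: pos_def_def inner_commute)
    have "z = s + d" by (simp add: d_def)
    then show ?thesis
      unfolding d_def[symmetric]
      by (simp add: wnorm_sq_def matrix_vector_right_distrib inner_simps dBs sBd)
  qed
  have "min_norm_sol A B b = s"
    unfolding min_norm_sol_def arg_min_def
  proof (rule some_equality)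
    show "is_arg_min (\<lambda>x. 1/2 * wnorm_sq B x) (\<lambda>x. A *v x = b) s"
      unfolding is_arg_min_linorder
    proof (intro conjI allI impI)
      fix z assume "A *v z = b"
      then show "1/2 * wnorm_sq B s \<le> 1/2 * wnorm_sq B z"
        using pythagoras[of z] wnorm_sq_nonneg[OF B, of "z - s"] by simp
    qed (rule As)
  next
    fix z assume "is_arg_min (\<lambda>x. 1/2 * wnorm_sq B x) (\<lambda>x. A *v x = b) z"
    then have z: "A *v z = b" "wnorm_sq B z \<le> wnorm_sq B s"
      unfolding is_arg_min_linorder using As by auto
    show "z = s"
      using pythagoras[OF z(1)] z(2) wnorm_sq_pos[OF B, of "z - s"] by (cases "z - s = 0") auto
  qed
  then show "A *v min_norm_sol A B b = b"
    and "min_norm_sol A B b \<in> range ((*v) (matrix_inv B ** transpose A))"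
    using As by (auto simp: s_def)
qed

section \<open>The spectral constant\<close>

lemma continuous_on_MAX:
  fixes g :: "'i \<Rightarrow> 'a::topological_space \<Rightarrow> real"
  assumes "finite I" "I \<noteq> {}" "\<And>i. i \<in> I \<Longrightarrow> continuous_on U (g i)"
  shows "continuous_on U (\<lambda>v. MAX i\<in>I. g i v)"
  using assms
proof (induction rule: finite_ne_induct)
  case (insert i J)
  then show ?case by (auto intro: continuous_on_max)
qed simp

text \<open>
  A least value is a lower bound only if it is attained. The quotient is invariant under scaling,
  so it suffices to look at the unit sphere of the range, where it is continuous and the sphere is
  compact.
\<close>
lemma sigma_inf_sq_le:
  fixes A :: "real^'n^'m" and S :: "nat \<Rightarrow> real^'t^'m"
  assumes B: "pos_def B" and q: "q \<ge> 1"
    and v: "v \<in> range ((*v) (matrix_inv B ** transpose A))" "v \<noteq> 0"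
  shows "sigma_inf_sq A B q S \<le> (MAX i\<in>{1..q}. wnorm_sq (sketch_H A B (S i)) (A *v v)) / wnorm_sq B v"
proof -
  define V where "V = range ((*v) (matrix_inv B ** transpose A))"
  define g where "g u = (MAX i\<in>{1..q}. wnorm_sq (sketch_H A B (S i)) (A *v u) / wnorm_sq B u)" for u
  have V: "subspace V" unfolding V_def by (intro linear_subspace_image) auto
  have g_scale: "g (c *\<^sub>R u) = g u" if "c \<noteq> 0" for c u
    using that by (simp add: g_def wnorm_sq_def matrix_vector_mult_scaleR)
  let ?K = "V \<inter> sphere 0 1"
  have normalize: "(1 / norm u) *\<^sub>R u \<in> ?K" if "u \<in> V" "u \<noteq> 0" for u
    using that V by (simp add: subspace_scale)
  have compact: "compact ?K" by (simp add: V closed_Int_compact closed_subspace)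
  have nonempty: "?K \<noteq> {}" using normalize v unfolding V_def by blast
  have continuous: "continuous_on ?K g"
    unfolding g_def wnorm_sq_def
  proof (intro continuous_on_MAX continuous_intros ballI)
    fix u assume "u \<in> ?K"
    then have "u \<noteq> 0" by auto
    then show "u \<bullet> (B *v u) \<noteq> 0" using B by (auto simp: pos_def_def)
  qed (use q in \<open>auto simp: matrix_vector_mul_assoc intro: continuous_intros\<close>)
  obtain m where m: "m \<in> ?K" "\<And>u. u \<in> ?K \<Longrightarrow> g m \<le> g u"
    using continuous_attains_inf[OF compact nonempty continuous] by blast
  have le: "g m \<le> g u" if "u \<in> V" "u \<noteq> 0" for u
    using m(2)[OF normalize[OF that]] g_scale[of "1 / norm u" u] that by simp
  have "sigma_inf_sq A B q S = (LEAST s. s \<in> {g u | u. u \<noteq> 0 \<and> u \<in> V})"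
    by (simp add: sigma_inf_sq_def g_def V_def wnorm_sq_sketch_Z[OF B])
  also have "\<dots> = g m"
    by (rule Least_equality) (use m(1) le in auto)
  also have "\<dots> \<le> g v" using le v by (simp add: V_def)
  also have "g v = (MAX i\<in>{1..q}. wnorm_sq (sketch_H A B (S i)) (A *v v)) / wnorm_sq B v"
  proof -
    have "mono (\<lambda>r. r / wnorm_sq B v)"
      by (intro monoI divide_right_mono wnorm_sq_nonneg[OF B])
    from mono_Max_commute[OF this, of "(\<lambda>i. wnorm_sq (sketch_H A B (S i)) (A *v v)) ` {1..q}"]
    show ?thesis using q by (simp add: g_def image_image)
  qed
  finally show ?thesis .
qed

text \<open>
  By \<open>wnorm_sq_sketch_step\<close>, \<open>\<parallel>A v\<parallel>\<^sup>2\<close> in any of the seminorms is the difference of \<open>\<parallel>v\<parallel>\<^sup>2\<close>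
  and another squared \<open>B\<close>-norm, so every quotient is at most 1. The hypothesis \<open>A \<noteq> 0\<close> provides a
  vector \<open>v \<noteq> 0\<close> in the range to which this applies.
\<close>
lemma sigma_inf_sq_le_one:
  fixes A :: "real^'n^'m" and S :: "nat \<Rightarrow> real^'t^'m"
  assumes "A \<noteq> 0" and B: "pos_def B" and q: "q \<ge> 1"
  shows "sigma_inf_sq A B q S \<le> 1"
proof -
  have "\<exists>w. (matrix_inv B ** transpose A) *v w \<noteq> 0"
  proof (rule ccontr)
    assume "\<not> ?thesis"
    then have 0: "matrix_inv B ** transpose A = 0" by (simp add: matrix_eq)
    have "transpose A = B ** (matrix_inv B ** transpose A)"
      by (simp add: matrix_mul_assoc pos_def_matrix_inv[OF B])
    then have "transpose A = 0" by (simp add: 0)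
    then show False using \<open>A \<noteq> 0\<close> by (simp add: transpose_eq_zero_iff)
  qed
  then obtain v where v: "v \<in> range ((*v) (matrix_inv B ** transpose A))" "v \<noteq> 0" by blast
  have "(MAX i\<in>{1..q}. wnorm_sq (sketch_H A B (S i)) (A *v v)) \<le> wnorm_sq B v"
  proof (rule Max.boundedI)
    fix a assume "a \<in> (\<lambda>i. wnorm_sq (sketch_H A B (S i)) (A *v v)) ` {1..q}"
    then obtain i where a: "a = wnorm_sq (sketch_H A B (S i)) (A *v v)" by blast
    show "a \<le> wnorm_sq B v"
      unfolding a using wnorm_sq_sketch_step[OF B, of v A "S i"] wnorm_sq_nonneg[OF B]
      by (metis diff_ge_0_iff_ge)
  qed (use q in auto)
  then have "(MAX i\<in>{1..q}. wnorm_sq (sketch_H A B (S i)) (A *v v)) / wnorm_sq B v \<le> 1"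
    using wnorm_sq_pos[OF B v(2)] by simp
  then show ?thesis using sigma_inf_sq_le[OF B q v, of S] by linarith
qed

section \<open>Convergence of the max-distance method\<close>

theorem theorem8:
  fixes A :: "real^'n^'m" and B :: "real^'n^'n" and b :: "real^'m"
    and q :: nat and S :: "nat \<Rightarrow> real^'t^'m"
    and x :: "nat \<Rightarrow> real^'n" and ik :: "nat \<Rightarrow> nat"
  assumes "A \<noteq> 0"
    and "\<exists>y. A *v y = b"
    and "pos_def B"
    and "q \<ge> 1"
    and "x 0 \<in> range ((*v) (matrix_inv B ** transpose A))"
    and "\<And>k. is_arg_max (\<lambda>i. sketch_loss A B b (S i) (x k)) (\<lambda>i. i \<in> {1..q}) (ik k)"
    and "\<And>k. x (Suc k) = x k -
           (matrix_inv B ** transpose A ** sketch_H A B (S (ik k))) *v (A *v x k - b)"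
  shows "\<forall>k. wnorm_sq B (x k - min_norm_sol A B b)
           \<le> (1 - sigma_inf_sq A B q S) ^ k * wnorm_sq B (x 0 - min_norm_sol A B b)"
proof -
  let ?H = "\<lambda>i. sketch_H A B (S i)"
  let ?V = "range ((*v) (matrix_inv B ** transpose A))"
  define \<sigma> where "\<sigma> = sigma_inf_sq A B q S"
  define e where "e k = x k - min_norm_sol A B b" for k
  note B = assms(3)
  note sol = min_norm_sol_props[OF B assms(2)]
  have V: "subspace ?V" by (intro linear_subspace_image) auto
  have residual: "A *v x k - b = A *v e k" for k
    by (simp add: e_def matrix_vector_mult_diff_distrib sol(1))
  have step: "e (Suc k) = e k - (matrix_inv B ** transpose A ** ?H (ik k)) *v (A *v e k)" for k
    using assms(7)[of k] by (simp add: residual) (simp add: e_def)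
  have eV: "e k \<in> ?V" for k
  proof (induction k)
    case 0
    show ?case unfolding e_def by (rule subspace_diff[OF V assms(5) sol(2)])
  next
    case (Suc k)
    have "(matrix_inv B ** transpose A ** ?H (ik k)) *v (A *v e k) \<in> ?V"
      by (simp add: matrix_vector_mul_assoc[symmetric] del: transpose_matrix_vector)
    with Suc show ?case unfolding step by (rule subspace_diff[OF V])
  qed
  have max: "(MAX i\<in>{1..q}. wnorm_sq (?H i) (A *v e k)) = wnorm_sq (?H (ik k)) (A *v e k)" for k
    using assms(6)[of k] unfolding is_arg_max_linorder sketch_loss_def residual
    by (intro Max_eqI) auto
  have contraction: "wnorm_sq B (e (Suc k)) \<le> (1 - \<sigma>) * wnorm_sq B (e k)" for k
  proof -
    have "\<sigma> * wnorm_sq B (e k) \<le> wnorm_sq (?H (ik k)) (A *v e k)"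
    proof (cases "e k = 0")
      case False
      with sigma_inf_sq_le[OF B assms(4) eV False, of S] wnorm_sq_pos[OF B False]
      show ?thesis unfolding max \<sigma>_def by (simp add: field_simps)
    qed simp
    then show ?thesis
      using wnorm_sq_sketch_step[OF B, of "e k" A "S (ik k)"] by (simp add: step algebra_simps)
  qed
  have \<sigma>1: "0 \<le> 1 - \<sigma>"
    using sigma_inf_sq_le_one[OF assms(1) B assms(4)] by (simp add: \<sigma>_def)
  have "wnorm_sq B (e k) \<le> (1 - \<sigma>) ^ k * wnorm_sq B (e 0)" for k
  proof (induction k)
    case (Suc k)
    have "wnorm_sq B (e (Suc k)) \<le> (1 - \<sigma>) * wnorm_sq B (e k)" by (rule contraction)
    also have "\<dots> \<le> (1 - \<sigma>) * ((1 - \<sigma>) ^ k * wnorm_sq B (e 0))"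
      by (rule mult_left_mono[OF Suc \<sigma>1])
    finally show ?case by (simp add: mult.assoc)
  qed simp
  then show ?thesis by (simp add: e_def \<sigma>_def)
qed

end
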